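(* Let $k>0$ and $r_{\rm o}>0$. For the family of spherical surfaces $\Gamma(r)\subset\mathbb{R}^3$ of radius $r>0$ (concentric, parametrized by their radius $r$), let $\lambda_{-n}^{+}(r)$, $n=-1,0,1,2,\dots$, be the symbols of the outgoing Dirichlet-to-Neumann operator on $\Gamma(r)$, as defined in the context. Then the symbols have the following dependence on the parameter $r$: for every $n=-1,0,1,2,\dots$ and every $r>0$, $$\lambda_{-n}^{+}(r) = \left(\frac{r_{\rm o}}{r}\right)^{n+1} \lambda_{-n}^{+}(r_{\rm o}),$$ where $\lambda_{-n}^{+}(r_{\rm o})$ is independent of $r$.
   Context: Let $k>0$ be the wavenumber. For $r>0$ let $\Gamma(r)=\{x\in\mathbb{R}^3: |x|=r\}$. All spheres $\Gamma(r)$ are identified with the unit sphere $S^2$ by radial projection $x\mapsto x/|x|$, so that operators acting on smooth functions on $\Gamma(r)$ are regarded as operators acting on $C^\infty(S^2)$ (complex-valued functions) that depend on the parameter $r$. Let $\Delta_{\Gamma(r)}$ denote the Laplace--Beltrami operator of $\Gamma(r)$ (with the metric induced from $\mathbb{R}^3$), $\mathcal{H}(r)$ the mean curvature of $\Gamma(r)$ (with the convention $\mathcal{H}(r)=1/r$), and $\mathcal{K}(r)$ the Gauss curvature of $\Gamma(r)$ (so $\mathcal{K}(r)=1/r^2$). Scalars act as multiplication operators. The symbols $\lambda_{-n}^{+}=\lambda_{-n}^{+}(r)$, $n=-1,0,1,2,\dots$, in the expansion $\lambda^{+}\sim\sum_{n\ge -1}\lambda_{-n}^{+}$ (in decreasing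 powers of $k$) of the symbol of the outgoing Dirichlet-to-Neumann operator for the Helmholtz equation $\Delta u+k^2u=0$ are the operator-valued functions of $r$ given by $$\lambda_{1}^{+} = ik,\qquad \lambda_{0}^{+} = -\mathcal{H},\qquad \lambda_{-1}^{+} = \frac{i}{2k}\left(\Delta_{\Gamma(r)} + \mathcal{H}^2 - \mathcal{K}\right),$$ and recursively, for $n\ge 1$, $$\lambda_{-n-1}^{+} = \frac{i}{2k}\left[\partial_r \lambda_{-n}^{+} + \sum_{j=1}^{n-1}\lambda_{-j}^{+}\,\lambda_{j-n}^{+}\right],$$ where the sum is empty (zero) when $n=1$, products are compositions of operators, and $\partial_r\lambda_{-n}^{+}$ is the derivative of the operator family with respect to the parameter $r$, i.e. $(\partial_r\lambda_{-n}^{+})(r)\,g=\frac{d}{dr}\left[\lambda_{-n}^{+}(r)\,g\right]$ for each fixed $g\in C^\infty(S^2)$. *)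

theory Defs
  imports "HOL-Analysis.Analysis"
begin

section \<open>Calculus on surfaces in Euclidean 3-space\<close>

definition tangent_space :: "(real^3) set \<Rightarrow> real^3 \<Rightarrow> (real^3) set" where
  "tangent_space S x = {v. \<exists>\<gamma> e. e > 0 \<and> (\<forall>t\<in>{-e<..<e}. \<gamma> t \<in> S) \<and> \<gamma> 0 = x \<and>
     (\<gamma> has_vector_derivative v) (at 0)}"

definition is_tangent_frame :: "(real^3) set \<Rightarrow> real^3 \<Rightarrow> (real^3) \<times> (real^3) \<Rightarrow> bool" where
  "is_tangent_frame S x = (\<lambda>(e1, e2). norm e1 = 1 \<and> norm e2 = 1 \<and> e1 \<bullet> e2 = 0 \<and>
     span {e1, e2} = tangent_space S x)"

text \<open>
  An orthonormal basis of the tangent plane. It is only used in traces and determinants, which do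
  not depend on the choice.
\<close>

definition tangent_frame :: "(real^3) set \<Rightarrow> real^3 \<Rightarrow> (real^3) \<times> (real^3)" where
  "tangent_frame S x = (SOME b. is_tangent_frame S x b)"

text \<open>
  Derivatives of functions on a surface are derivatives within the surface. Such a derivative is not
  unique as a linear map on the ambient space, but its values on tangent vectors are, and only these
  are used (see \<open>frechet_derivative_tangent\<close> below). The value at points
  of non-differentiability is set to zero.
\<close>

definition surface_grad :: "(real^3) set \<Rightarrow> (real^3 \<Rightarrow> real) \<Rightarrow> real^3 \<Rightarrow> real^3" where
  "surface_grad S f x =
    (if f differentiable (at x within S)
     then THE G. G \<in> tangent_space S x \<and>
            (\<forall>v\<in>tangent_space S x. G \<bullet> v = frechet_derivative f (at x within S) v)
     else 0)"

text \<open>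
  The trace of the tangential part of the derivative of \<open>X\<close>; for a tangential field \<open>X\<close> this is the
  trace of the covariant derivative of the metric induced from the ambient space.
\<close>

definition surface_div :: "(real^3) set \<Rightarrow> (real^3 \<Rightarrow> real^3) \<Rightarrow> real^3 \<Rightarrow> real" where
  "surface_div S X x =
    (if X differentiable (at x within S)
     then let D = frechet_derivative X (at x within S); (e1, e2) = tangent_frame S x
          in D e1 \<bullet> e1 + D e2 \<bullet> e2
     else 0)"

definition laplace_beltrami :: "(real^3) set \<Rightarrow> (real^3 \<Rightarrow> real) \<Rightarrow> real^3 \<Rightarrow> real" where
  "laplace_beltrami S f = surface_div S (surface_grad S f)"

text \<open>The extension to complex-valued functions by complex linearity.\<close>

definition laplace_beltrami_complex ::
    "(real^3) set \<Rightarrow> (real^3 \<Rightarrow> complex) \<Rightarrow> real^3 \<Rightarrow> complex" where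
  "laplace_beltrami_complex S f x =
     Complex (laplace_beltrami S (\<lambda>y. Re (f y)) x) (laplace_beltrami S (\<lambda>y. Im (f y)) x)"

text \<open>
  Curvatures of a surface with unit normal field \<open>\<nu>\<close>: half the trace and the determinant of the
  derivative of \<open>\<nu>\<close> on the tangent plane. With this sign, a sphere with its outward normal has
  positive mean curvature.
\<close>

definition mean_curvature :: "(real^3) set \<Rightarrow> (real^3 \<Rightarrow> real^3) \<Rightarrow> real^3 \<Rightarrow> real" where
  "mean_curvature S \<nu> x = surface_div S \<nu> x / 2"

definition gauss_curvature :: "(real^3) set \<Rightarrow> (real^3 \<Rightarrow> real^3) \<Rightarrow> real^3 \<Rightarrow> real" where
  "gauss_curvature S \<nu> x =
    (let D = frechet_derivative \<nu> (at x within S); (e1, e2) = tangent_frame S x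
     in (D e1 \<bullet> e1) * (D e2 \<bullet> e2) - (D e1 \<bullet> e2) * (D e2 \<bullet> e1))"


section \<open>Spheres and smooth functions on the unit sphere\<close>

abbreviation Sph :: "real \<Rightarrow> (real^3) set" where
  "Sph r \<equiv> sphere 0 r"

fun Ck_on :: "nat \<Rightarrow> 'a::real_normed_vector set \<Rightarrow> ('a \<Rightarrow> 'b::real_normed_vector) \<Rightarrow> bool" where
  "Ck_on 0 U f \<longleftrightarrow> continuous_on U f"
| "Ck_on (Suc k) U f \<longleftrightarrow> (\<forall>x\<in>U. f differentiable (at x)) \<and>
     (\<forall>v. Ck_on k U (\<lambda>x. frechet_derivative f (at x) v))"

text \<open>
  Functions on the unit sphere are represented by functions on the ambient space whose values off the
  sphere are irrelevant.
\<close>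

definition smooth_sphere :: "(real^3 \<Rightarrow> complex) set" where
  "smooth_sphere = {g. \<exists>U F. open U \<and> Sph 1 \<subseteq> U \<and> (\<forall>k. Ck_on k U F) \<and> (\<forall>x\<in>Sph 1. F x = g x)}"

text \<open>
  The geometric quantities of the sphere of radius \<open>r\<close>, transported to the unit sphere by the radial
  projection \<open>sgn y = y / |y|\<close>, whose inverse is \<open>x \<mapsto> r x\<close>. The map \<open>sgn\<close> is also the
  outward unit normal field.
\<close>

definition Delta_Gamma :: "real \<Rightarrow> (real^3 \<Rightarrow> complex) \<Rightarrow> real^3 \<Rightarrow> complex" where
  "Delta_Gamma r g x = laplace_beltrami_complex (Sph r) (\<lambda>y. g (sgn y)) (r *\<^sub>R x)"

definition H_Gamma :: "real \<Rightarrow> real^3 \<Rightarrow> real" where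
  "H_Gamma r x = mean_curvature (Sph r) sgn (r *\<^sub>R x)"

definition K_Gamma :: "real \<Rightarrow> real^3 \<Rightarrow> real" where
  "K_Gamma r x = gauss_curvature (Sph r) sgn (r *\<^sub>R x)"


section \<open>The symbols\<close>

text \<open>
  \<open>dtn_symbol k m r\<close> is the operator with index \<open>m \<in> {1, 0, -1, -2, \<dots>}\<close>, the order in \<open>k\<close>;
  in the recursive case \<open>m = - n - 1\<close> with \<open>n \<ge> 1\<close>. Indices \<open>m > 1\<close> do not occur in the expansion
  and get the value zero.
\<close>

function dtn_symbol :: "real \<Rightarrow> int \<Rightarrow> real \<Rightarrow> (real^3 \<Rightarrow> complex) \<Rightarrow> real^3 \<Rightarrow> complex" where
  "dtn_symbol k m = (\<lambda>r g x.
     if m > 1 then 0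
     else if m = 1 then \<i> * of_real k * g x
     else if m = 0 then - of_real (H_Gamma r x) * g x
     else if m = -1 then
       \<i> / (2 * of_real k) *
         (Delta_Gamma r g x + of_real ((H_Gamma r x)\<^sup>2 - K_Gamma r x) * g x)
     else let n = - m - 1 in
       \<i> / (2 * of_real k) *
         (vector_derivative (\<lambda>s. dtn_symbol k (-n) s g x) (at r) +
          (\<Sum>j = 1..n - 1. dtn_symbol k (-j) r (dtn_symbol k (j - n) r g) x)))"
  by pat_completeness auto
termination
  by (relation "Wellfounded.measure (\<lambda>(k, m). nat (1 - m))") auto

declare dtn_symbol.simps [simp del]

lemma dtn_symbol_1: "dtn_symbol k 1 r g x = \<i> * of_real k * g x"
  by (simp add: dtn_symbol.simps)

lemma dtn_symbol_0: "dtn_symbol k 0 r g x = - of_real (H_Gamma r x) * g x"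
  by (simp add: dtn_symbol.simps)

lemma dtn_symbol_minus_1:
  "dtn_symbol k (-1) r g x = \<i> / (2 * of_real k) *
     (Delta_Gamma r g x + of_real ((H_Gamma r x)\<^sup>2 - K_Gamma r x) * g x)"
  by (simp add: dtn_symbol.simps)

lemma dtn_symbol_rec:
  assumes "n \<ge> 1"
  shows "dtn_symbol k (- n - 1) r g x = \<i> / (2 * of_real k) *
     (vector_derivative (\<lambda>s. dtn_symbol k (-n) s g x) (at r) +
      (\<Sum>j = 1..n - 1. dtn_symbol k (-j) r (dtn_symbol k (j - n) r g) x))"
  using assms by (subst dtn_symbol.simps) (simp add: Let_def)


section \<open>Consistency of the definitions\<close>

lemma frechet_derivative_tangent:
  fixes f :: "real^3 \<Rightarrow> 'b::real_normed_vector"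
  assumes D: "(f has_derivative D) (at x within S)" and v: "v \<in> tangent_space S x"
  shows "frechet_derivative f (at x within S) v = D v"
proof -
  obtain \<gamma> e where e: "e > 0" and \<gamma>: "\<forall>t\<in>{-e<..<e}. \<gamma> t \<in> S" "\<gamma> 0 = x"
    and d: "(\<gamma> has_vector_derivative v) (at 0)"
    using v unfolding tangent_space_def by blast
  have chain: "((f \<circ> \<gamma>) has_vector_derivative L v) (at 0)"
    if L: "(f has_derivative L) (at x within S)" for L
  proof -
    have "(f has_derivative L) (at (\<gamma> 0) within \<gamma> ` {-e<..<e})"
      using L \<gamma> by (auto intro: has_derivative_subset)
    moreover have "(\<gamma> has_derivative (\<lambda>h. h *\<^sub>R v)) (at 0 within {-e<..<e})"
      using d by (auto simp: has_vector_derivative_def intro: has_derivative_at_withinI)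
    ultimately have "((f \<circ> \<gamma>) has_derivative (L \<circ> (\<lambda>h. h *\<^sub>R v))) (at 0 within {-e<..<e})"
      by (intro diff_chain_within)
    moreover have "at (0::real) within {-e<..<e} = at 0"
      using e by (intro at_within_open) auto
    moreover have "L \<circ> (\<lambda>h. h *\<^sub>R v) = (\<lambda>h. h *\<^sub>R L v)"
      using linear_scale[OF has_derivative_linear[OF L]] by (auto simp: o_def)
    ultimately show ?thesis by (simp add: has_vector_derivative_def)
  qed
  have "(f has_derivative frechet_derivative f (at x within S)) (at x within S)"
    using D frechet_derivative_works differentiable_def by blast
  from chain[OF this] chain[OF D] show ?thesis
    by (rule vector_derivative_unique_at)
qed

lemma tangent_space_sphere:
  assumes r: "r > 0" and x: "x \<in> Sph r"
  shows "tangent_space (Sph r) x = {v. v \<bullet> x = 0}"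
proof (intro equalityI subsetI)
  fix v assume "v \<in> tangent_space (Sph r) x"
  then obtain \<gamma> e where e: "e > 0" and \<gamma>: "\<forall>t\<in>{-e<..<e}. \<gamma> t \<in> Sph r" "\<gamma> 0 = x"
    and d: "(\<gamma> has_derivative (\<lambda>h. h *\<^sub>R v)) (at 0)"
    unfolding tangent_space_def has_vector_derivative_def by blast
  have "((\<lambda>t. \<gamma> t \<bullet> \<gamma> t) has_derivative (\<lambda>h. \<gamma> 0 \<bullet> (h *\<^sub>R v) + (h *\<^sub>R v) \<bullet> \<gamma> 0)) (at 0)"
    by (rule has_derivative_inner[OF d d])
  moreover have "((\<lambda>t. \<gamma> t \<bullet> \<gamma> t) has_derivative (\<lambda>h. 0)) (at 0)"
  proof (rule has_derivative_transform_within_open[of "\<lambda>t. r\<^sup>2" _ _ _ "{-e<..<e}"])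
    show "r\<^sup>2 = \<gamma> t \<bullet> \<gamma> t" if "t \<in> {-e<..<e}" for t
      using \<gamma>(1) that by (auto simp: power2_norm_eq_inner[symmetric])
  qed (use e in auto)
  ultimately have "(\<lambda>h. \<gamma> 0 \<bullet> (h *\<^sub>R v) + (h *\<^sub>R v) \<bullet> \<gamma> 0) = (\<lambda>h. 0)"
    by (rule has_derivative_unique)
  from fun_cong[OF this, of 1] show "v \<in> {v. v \<bullet> x = 0}"
    using \<gamma>(2) by (simp add: inner_commute)
next
  fix v assume "v \<in> {v. v \<bullet> x = 0}"
  hence vx: "v \<bullet> x = 0" by simp
  have xx: "x \<bullet> x = r\<^sup>2" using x by (simp add: power2_norm_eq_inner[symmetric])
  define \<gamma> where "\<gamma> t = (r / norm (x + t *\<^sub>R v)) *\<^sub>R (x + t *\<^sub>R v)" for t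
  have n2: "norm (x + t *\<^sub>R v) = sqrt (r\<^sup>2 + t\<^sup>2 * (v \<bullet> v))" for t
    using vx xx by (simp add: norm_eq_sqrt_inner algebra_simps inner_commute power2_eq_square)
  have pos: "r\<^sup>2 + t\<^sup>2 * (v \<bullet> v) > 0" for t
    using r by (intro add_pos_nonneg) auto
  have nz: "norm (x + t *\<^sub>R v) > 0" for t
    using n2[of t] pos[of t] by simp
  have "((\<lambda>t. r / sqrt (r\<^sup>2 + t\<^sup>2 * (v \<bullet> v))) has_real_derivative 0) (at 0)"
    using r by (auto intro!: derivative_eq_intros)
  hence "((\<lambda>t. (r / sqrt (r\<^sup>2 + t\<^sup>2 * (v \<bullet> v))) *\<^sub>R (x + t *\<^sub>R v)) has_vector_derivative v) (at 0)"
    using r by (auto intro!: derivative_eq_intros)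
  hence "(\<gamma> has_vector_derivative v) (at 0)"
    by (simp add: \<gamma>_def[abs_def] n2)
  moreover have "\<forall>t\<in>{-1<..<1}. \<gamma> t \<in> Sph r"
    using nz r by (auto simp: \<gamma>_def)
  moreover have "\<gamma> 0 = x" using x r by (simp add: \<gamma>_def)
  ultimately show "v \<in> tangent_space (Sph r) x"
    unfolding tangent_space_def by (intro CollectI exI[of _ \<gamma>] exI[of _ 1]) auto
qed

lemma tangent_frame_sphere:
  assumes r: "r > 0" and x: "x \<in> Sph r"
  shows "is_tangent_frame (Sph r) x (tangent_frame (Sph r) x)"
proof -
  let ?T = "{v. v \<bullet> x = 0}"
  have x0: "x \<noteq> 0" using x r by auto
  have sub: "subspace ?T" by (auto simp: subspace_def inner_add_left)
  have dT: "dim ?T = 2"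
    using dim_hyperplane[OF x0] by (simp add: inner_commute)
  obtain B where B: "B \<subseteq> ?T" "pairwise orthogonal B" "\<And>y. y \<in> B \<Longrightarrow> norm y = 1"
    "independent B" "card B = dim ?T" "span B = ?T"
    using orthonormal_basis_subspace[OF sub] by metis
  from B(5) dT obtain a b where ab: "B = {a, b}" "a \<noteq> b"
    by (metis card_2_iff)
  have "is_tangent_frame (Sph r) x (a, b)"
    using B ab by (auto simp: is_tangent_frame_def tangent_space_sphere[OF r x] pairwise_def orthogonal_def)
  thus ?thesis unfolding tangent_frame_def by (rule someI)
qed

lemma normal_derivative_sphere:
  assumes r: "r > 0" and x: "x \<in> Sph r"
  shows "(sgn has_derivative (\<lambda>v. v /\<^sub>R r)) (at x within Sph r)"
proof (rule has_derivative_transform[where f = "\<lambda>y. y /\<^sub>R r"])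
  show "((\<lambda>y. y /\<^sub>R r) has_derivative (\<lambda>v. v /\<^sub>R r)) (at x within Sph r)"
    by (auto intro!: derivative_eq_intros)
qed (use x in \<open>auto simp: sgn_div_norm\<close>)

lemma curvature_sphere:
  assumes r: "r > 0" and x: "x \<in> Sph r"
  shows "mean_curvature (Sph r) sgn x = 1 / r" and "gauss_curvature (Sph r) sgn x = 1 / r\<^sup>2"
proof -
  obtain e1 e2 where e: "tangent_frame (Sph r) x = (e1, e2)" by fastforce
  have f: "norm e1 = 1" "norm e2 = 1" "e1 \<bullet> e2 = 0" "span {e1, e2} = tangent_space (Sph r) x"
    using tangent_frame_sphere[OF assms] by (auto simp: e is_tangent_frame_def)
  have "e1 \<in> tangent_space (Sph r) x" "e2 \<in> tangent_space (Sph r) x"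
    using f(4) span_superset[of "{e1, e2}"] by auto
  note D = this[THEN frechet_derivative_tangent[OF normal_derivative_sphere[OF assms]]]
  have d: "sgn differentiable (at x within Sph r)"
    using normal_derivative_sphere[OF assms] by (auto simp: differentiable_def)
  have n: "e1 \<bullet> e1 = 1" "e2 \<bullet> e2 = 1" "e2 \<bullet> e1 = 0"
    using f by (auto simp: dot_square_norm inner_commute)
  show "mean_curvature (Sph r) sgn x = 1 / r"
    using d by (simp add: mean_curvature_def surface_div_def Let_def e D n divide_simps)
  show "gauss_curvature (Sph r) sgn x = 1 / r\<^sup>2"
    by (simp add: gauss_curvature_def Let_def e D n f divide_simps power2_eq_square)
qed

lemma curvature_Gamma:
  assumes "r > 0" and "x \<in> Sph 1"
  shows "H_Gamma r x = 1 / r" and "K_Gamma r x = 1 / r\<^sup>2"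
  using assms curvature_sphere[of r "r *\<^sub>R x"] by (auto simp: H_Gamma_def K_Gamma_def)

lemma surface_grad_eqI:
  assumes D: "(f has_derivative D) (at x within S)" and sub: "subspace (tangent_space S x)"
    and G: "G \<in> tangent_space S x" "\<And>v. v \<in> tangent_space S x \<Longrightarrow> G \<bullet> v = D v"
  shows "surface_grad S f x = G"
proof -
  have d: "f differentiable (at x within S)" using D by (auto simp: differentiable_def)
  have "(THE G. G \<in> tangent_space S x \<and>
      (\<forall>v\<in>tangent_space S x. G \<bullet> v = frechet_derivative f (at x within S) v)) = G"
  proof (rule the_equality)
    show "G \<in> tangent_space S x \<and>
      (\<forall>v\<in>tangent_space S x. G \<bullet> v = frechet_derivative f (at x within S) v)"
      using G frechet_derivative_tangent[OF D] by auto
  next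
    fix G' assume G': "G' \<in> tangent_space S x \<and>
      (\<forall>v\<in>tangent_space S x. G' \<bullet> v = frechet_derivative f (at x within S) v)"
    hence *: "(G' - G) \<bullet> v = 0" if "v \<in> tangent_space S x" for v
      using that G frechet_derivative_tangent[OF D] by (auto simp: inner_diff_left)
    have "G' - G \<in> tangent_space S x" using G' G sub by (auto intro: subspace_diff)
    from *[OF this] show "G' = G" by simp
  qed
  thus ?thesis using d by (simp add: surface_grad_def)
qed

text \<open>Linear functions restrict to eigenfunctions for the eigenvalue \<open>-2 / r\<^sup>2\<close>.\<close>

lemma laplace_beltrami_sphere_linear:
  assumes r: "r > 0" and x: "x \<in> Sph r"
  shows "laplace_beltrami (Sph r) (\<lambda>y. a \<bullet> y) x = - 2 / r\<^sup>2 * (a \<bullet> x)"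
proof -
  have grad: "surface_grad (Sph r) (\<lambda>y. a \<bullet> y) y = a - ((a \<bullet> y) / r\<^sup>2) *\<^sub>R y"
    if y: "y \<in> Sph r" for y
  proof (rule surface_grad_eqI)
    have yy: "y \<bullet> y = r\<^sup>2" using y by (simp add: power2_norm_eq_inner[symmetric])
    show "((\<lambda>y. a \<bullet> y) has_derivative (\<lambda>v. a \<bullet> v)) (at y within Sph r)"
      by (auto intro!: derivative_eq_intros)
    show "subspace (tangent_space (Sph r) y)"
      by (auto simp: tangent_space_sphere[OF r y] subspace_def inner_add_left)
    show "a - ((a \<bullet> y) / r\<^sup>2) *\<^sub>R y \<in> tangent_space (Sph r) y"
      using r yy by (simp add: tangent_space_sphere[OF r y] inner_diff_left)
    show "(a - ((a \<bullet> y) / r\<^sup>2) *\<^sub>R y) \<bullet> v = a \<bullet> v" if "v \<in> tangent_space (Sph r) y" for v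
      using that by (simp add: tangent_space_sphere[OF r y] inner_diff_left inner_commute[of y v])
  qed
  let ?D = "\<lambda>v. - (((a \<bullet> x) / r\<^sup>2) *\<^sub>R v + ((a \<bullet> v) / r\<^sup>2) *\<^sub>R x)"
  have D: "(surface_grad (Sph r) (\<lambda>y. a \<bullet> y) has_derivative ?D) (at x within Sph r)"
  proof (rule has_derivative_transform[where f = "\<lambda>y. a - ((a \<bullet> y) / r\<^sup>2) *\<^sub>R y"])
    show "((\<lambda>y. a - ((a \<bullet> y) / r\<^sup>2) *\<^sub>R y) has_derivative ?D) (at x within Sph r)"
      using r by (auto intro!: derivative_eq_intros simp: fun_eq_iff power2_eq_square power4_eq_xxxx)
  qed (use x grad in auto)
  obtain e1 e2 where e: "tangent_frame (Sph r) x = (e1, e2)" by fastforce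
  have f: "norm e1 = 1" "norm e2 = 1" "span {e1, e2} = tangent_space (Sph r) x"
    using tangent_frame_sphere[OF assms] by (auto simp: e is_tangent_frame_def)
  have t: "e1 \<in> tangent_space (Sph r) x" "e2 \<in> tangent_space (Sph r) x"
    using f(3) span_superset[of "{e1, e2}"] by auto
  have o: "x \<bullet> e1 = 0" "x \<bullet> e2 = 0"
    using t by (auto simp: tangent_space_sphere[OF assms] inner_commute)
  have n: "e1 \<bullet> e1 = 1" "e2 \<bullet> e2 = 1"
    using f by (auto simp: dot_square_norm)
  show ?thesis
    using D t[THEN frechet_derivative_tangent[OF D]]
    by (auto simp: laplace_beltrami_def surface_div_def differentiable_def Let_def e o n
        inner_diff_left inner_add_left)
qed

end

theory Submission
  imports Defs
begin

text \<open>
  The dilation by \<open>r / s\<close> maps the sphere of radius \<open>s\<close> onto that of radius \<open>r\<close>, so each first-order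
  derivative on the sphere picks up a factor \<open>s / r\<close>; since \<open>\<H>\<^sup>2 = \<K>\<close> on spheres, the symbol of
  index \<open>1 - N\<close> scales with the factor \<open>(s / r)^N\<close> for \<open>N \<le> 2\<close>. Both \<open>\<partial>\<^sub>r\<close> and the composition
  terms of the recursion raise the exponent by one. To apply the scaling twice in a composition, the
  induction also carries real homogeneity of the symbols and the fact that they only see the values
  of their argument on the unit sphere. A derivative that fails to exist
  does so on all spheres simultaneously, so the junk value \<open>0\<close> scales as well.
\<close>

lemma tangent_frame_Sph_memD:
  assumes "r > 0" "x \<in> Sph r" "tangent_frame (Sph r) x = (e1, e2)"
  shows "e1 \<in> tangent_space (Sph r) x" "e2 \<in> tangent_space (Sph r) x"
  using tangent_frame_sphere[OF assms(1,2)] span_superset[of "{e1, e2}"]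
  by (auto simp: assms(3) is_tangent_frame_def)

lemma Sph_scale:
  assumes "r > 0" "s > 0" "y \<in> Sph s"
  shows "(r / s) *\<^sub>R y \<in> Sph r"
  using assms by simp

lemma tangent_space_Sph_scale:
  assumes "r > 0" "s > 0" "y \<in> Sph s"
  shows "tangent_space (Sph r) ((r / s) *\<^sub>R y) = tangent_space (Sph s) y"
  using tangent_space_sphere[OF assms(1) Sph_scale[OF assms]] tangent_space_sphere[OF assms(2,3)] assms
  by auto

text \<open>The frame is chosen by \<open>SOME\<close> from a predicate that sees sphere and point
  only through the tangent space. Equal tangent spaces therefore give literally the same frame, so
  traces on both spheres use the same vectors.\<close>

lemma tangent_frame_Sph_scale:
  assumes "r > 0" "s > 0" "y \<in> Sph s"
  shows "tangent_frame (Sph r) ((r / s) *\<^sub>R y) = tangent_frame (Sph s) y"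
  by (simp add: tangent_frame_def is_tangent_frame_def tangent_space_Sph_scale[OF assms])

text \<open>Chain rule for the dilation by \<open>s / r\<close>, which maps \<open>Sph r\<close>
  onto \<open>Sph s\<close>. The constant \<open>c\<close> allows a second application to the
  gradient, which already carries a factor \<open>s / r\<close>.\<close>

lemma has_derivative_Sph_scale:
  fixes f f' :: "real^3 \<Rightarrow> 'b::real_normed_vector"
  assumes r: "r > 0" and s: "s > 0" and y: "y \<in> Sph s"
    and eq: "\<And>z. z \<in> Sph s \<Longrightarrow> f' ((r / s) *\<^sub>R z) = c *\<^sub>R f z"
    and D: "(f has_derivative D) (at y within Sph s)"
  shows "(f' has_derivative (\<lambda>v. (c * (s / r)) *\<^sub>R D v)) (at ((r / s) *\<^sub>R y) within Sph r)"
proof (rule has_derivative_transform[where f = "\<lambda>z. c *\<^sub>R f ((s / r) *\<^sub>R z)"])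
  have img: "(\<lambda>z. (s / r) *\<^sub>R z) ` Sph r \<subseteq> Sph s"
    using Sph_scale[OF s r] by blast
  have outer: "(f has_derivative D) (at ((s / r) *\<^sub>R ((r / s) *\<^sub>R y)) within (\<lambda>z. (s / r) *\<^sub>R z) ` Sph r)"
    using has_derivative_subset[OF D img] r s by simp
  have inner: "((\<lambda>z. (s / r) *\<^sub>R z) has_derivative (\<lambda>v. (s / r) *\<^sub>R v))
      (at ((r / s) *\<^sub>R y) within Sph r)"
    by (auto intro!: derivative_eq_intros)
  have "((\<lambda>z. f ((s / r) *\<^sub>R z)) has_derivative (\<lambda>v. D ((s / r) *\<^sub>R v)))
      (at ((r / s) *\<^sub>R y) within Sph r)"
    using diff_chain_within[OF inner outer] by (simp only: o_def)
  from has_derivative_scaleR_right[OF this, of c]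
  show "((\<lambda>z. c *\<^sub>R f ((s / r) *\<^sub>R z)) has_derivative (\<lambda>v. (c * (s / r)) *\<^sub>R D v))
      (at ((r / s) *\<^sub>R y) within Sph r)"
    using linear_scale[OF has_derivative_linear[OF D]] by simp
  show "(r / s) *\<^sub>R y \<in> Sph r"
    using Sph_scale[OF r s y] .
  show "f' z = c *\<^sub>R f ((s / r) *\<^sub>R z)" if "z \<in> Sph r" for z
    using eq[OF Sph_scale[OF s r that]] r s by simp
qed

text \<open>Swapping \<open>r\<close> with \<open>s\<close> and \<open>c\<close> with
  \<open>1 / c\<close> preserves the hypothesis, so one direction gives the other. The equivalence
  makes the default value 0 occur on both spheres at once.\<close>

lemma differentiable_Sph_scale_iff:
  fixes f f' :: "real^3 \<Rightarrow> 'b::real_normed_vector"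
  assumes r: "r > 0" and s: "s > 0" and c: "c \<noteq> 0" and y: "y \<in> Sph s"
    and eq: "\<And>z. z \<in> Sph s \<Longrightarrow> f' ((r / s) *\<^sub>R z) = c *\<^sub>R f z"
  shows "f' differentiable (at ((r / s) *\<^sub>R y) within Sph r) \<longleftrightarrow>
    f differentiable (at y within Sph s)"
proof
  assume "f' differentiable (at ((r / s) *\<^sub>R y) within Sph r)"
  then obtain D where D: "(f' has_derivative D) (at ((r / s) *\<^sub>R y) within Sph r)"
    by (auto simp: differentiable_def)
  have "f ((s / r) *\<^sub>R z) = (1 / c) *\<^sub>R f' z" if "z \<in> Sph r" for z
    using eq[OF Sph_scale[OF s r that]] r s c by simp
  from has_derivative_Sph_scale[OF s r Sph_scale[OF r s y] this D]
  show "f differentiable (at y within Sph s)"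
    using r s by (auto simp: differentiable_def)
next
  assume "f differentiable (at y within Sph s)"
  thus "f' differentiable (at ((r / s) *\<^sub>R y) within Sph r)"
    using has_derivative_Sph_scale[where f' = f', OF r s y eq] by (auto simp: differentiable_def)
qed

lemma surface_grad_Sph_scale:
  assumes r: "r > 0" and s: "s > 0" and c: "c \<noteq> 0" and y: "y \<in> Sph s"
    and eq: "\<And>z. z \<in> Sph s \<Longrightarrow> f' ((r / s) *\<^sub>R z) = c * f z"
  shows "surface_grad (Sph r) f' ((r / s) *\<^sub>R y) = (c * (s / r)) *\<^sub>R surface_grad (Sph s) f y"
proof (cases "f differentiable (at y within Sph s)")
  case False
  thus ?thesis
    using differentiable_Sph_scale_iff[OF r s c y, of f' f] eq by (simp add: surface_grad_def)
next
  case True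
  then obtain D where D: "(f has_derivative D) (at y within Sph s)"
    by (auto simp: differentiable_def)
  \<comment> \<open>The Riesz vector of the functional \<open>D\<close>; removing its radial
    component yields the tangential gradient.\<close>
  let ?G0 = "adjoint D 1"
  define G where "G = ?G0 - ((?G0 \<bullet> y) / s\<^sup>2) *\<^sub>R y"
  have yy: "y \<bullet> y = s\<^sup>2"
    using y by (simp add: power2_norm_eq_inner[symmetric])
  note T = tangent_space_sphere[OF s y]
  have sub: "subspace (tangent_space (Sph s) y)"
    by (auto simp: T subspace_def inner_add_left)
  have GT: "G \<in> tangent_space (Sph s) y"
    using s yy by (simp add: T G_def inner_diff_left)
  have GD: "G \<bullet> v = D v" if "v \<in> tangent_space (Sph s) y" for v
    using that adjoint_works[OF has_derivative_linear[OF D], of v 1]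
    by (simp add: T G_def inner_diff_right inner_commute)
  have "surface_grad (Sph s) f y = G"
    using surface_grad_eqI[OF D sub GT GD] .
  moreover have "surface_grad (Sph r) f' ((r / s) *\<^sub>R y) = (c * (s / r)) *\<^sub>R G"
  proof (rule surface_grad_eqI)
    show "(f' has_derivative (\<lambda>v. (c * (s / r)) *\<^sub>R D v)) (at ((r / s) *\<^sub>R y) within Sph r)"
      using has_derivative_Sph_scale[OF r s y _ D] eq by simp
  qed (use sub GT GD in \<open>auto simp: tangent_space_Sph_scale[OF r s y] intro: subspace_scale\<close>)
  ultimately show ?thesis by simp
qed

lemma surface_div_Sph_scale:
  assumes r: "r > 0" and s: "s > 0" and c: "c \<noteq> 0" and y: "y \<in> Sph s"
    and eq: "\<And>z. z \<in> Sph s \<Longrightarrow> X' ((r / s) *\<^sub>R z) = c *\<^sub>R X z"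
  shows "surface_div (Sph r) X' ((r / s) *\<^sub>R y) = c * (s / r) * surface_div (Sph s) X y"
proof (cases "X differentiable (at y within Sph s)")
  case False
  thus ?thesis
    using differentiable_Sph_scale_iff[where f = X and f' = X', OF r s c y eq]
    by (simp add: surface_div_def)
next
  case True
  then obtain D where D: "(X has_derivative D) (at y within Sph s)"
    by (auto simp: differentiable_def)
  have D': "(X' has_derivative (\<lambda>v. (c * (s / r)) *\<^sub>R D v)) (at ((r / s) *\<^sub>R y) within Sph r)"
    using has_derivative_Sph_scale[OF r s y eq D] .
  obtain e1 e2 where e: "tangent_frame (Sph s) y = (e1, e2)" by fastforce
  note t = tangent_frame_Sph_memD[OF s y e]
  have t': "e1 \<in> tangent_space (Sph r) ((r / s) *\<^sub>R y)" "e2 \<in> tangent_space (Sph r) ((r / s) *\<^sub>R y)"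
    using t by (simp_all add: tangent_space_Sph_scale[OF r s y])
  have d': "X' differentiable (at ((r / s) *\<^sub>R y) within Sph r)"
    using D' by (auto simp: differentiable_def)
  show ?thesis
    unfolding surface_div_def Let_def tangent_frame_Sph_scale[OF r s y] e
    using True d' t[THEN frechet_derivative_tangent[OF D]] t'[THEN frechet_derivative_tangent[OF D']]
    by (simp add: distrib_left)
qed

lemma laplace_beltrami_Sph_scale:
  assumes r: "r > 0" and s: "s > 0" and c: "c \<noteq> 0" and y: "y \<in> Sph s"
    and eq: "\<And>z. z \<in> Sph s \<Longrightarrow> f' ((r / s) *\<^sub>R z) = c * f z"
  shows "laplace_beltrami (Sph r) f' ((r / s) *\<^sub>R y) = c * (s / r)\<^sup>2 * laplace_beltrami (Sph s) f y"
proof -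
  have c': "c * (s / r) \<noteq> 0" using r s c by simp
  have "surface_grad (Sph r) f' ((r / s) *\<^sub>R z) = (c * (s / r)) *\<^sub>R surface_grad (Sph s) f z"
    if "z \<in> Sph s" for z
    using surface_grad_Sph_scale[OF r s c that] eq by blast
  from surface_div_Sph_scale[where X' = "surface_grad (Sph r) f'", OF r s c' y this]
  show ?thesis
    by (simp add: laplace_beltrami_def power2_eq_square)
qed

text \<open>A real factor passes through real and imaginary parts, which the operator treats
  separately, and \<open>sgn\<close> is invariant under positive dilations.\<close>

lemma Delta_Gamma_scale:
  assumes r: "r > 0" and s: "s > 0" and c: "c \<noteq> 0" and x: "x \<in> Sph 1"
    and eq: "\<And>y. y \<in> Sph 1 \<Longrightarrow> g' y = of_real c * g y"
  shows "Delta_Gamma r g' x = of_real (c * (s / r)\<^sup>2) * Delta_Gamma s g x"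
proof -
  have sx: "s *\<^sub>R x \<in> Sph s" using s x by simp
  have rx: "r *\<^sub>R x = (r / s) *\<^sub>R (s *\<^sub>R x)" using s by simp
  have sgn_eq: "g' (sgn ((r / s) *\<^sub>R z)) = of_real c * g (sgn z)" if "z \<in> Sph s" for z
  proof -
    have "sgn ((r / s) *\<^sub>R z) = sgn z" using r s by (simp add: sgn_scaleR)
    moreover have "z \<noteq> 0" using s that by auto
    ultimately show ?thesis using eq[of "sgn z"] by (simp add: norm_sgn)
  qed
  have "laplace_beltrami (Sph r) (\<lambda>y. Re (g' (sgn y))) (r *\<^sub>R x) =
      c * (s / r)\<^sup>2 * laplace_beltrami (Sph s) (\<lambda>y. Re (g (sgn y))) (s *\<^sub>R x)"
    unfolding rx by (rule laplace_beltrami_Sph_scale[OF r s c sx]) (simp only: sgn_eq, simp)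
  moreover have "laplace_beltrami (Sph r) (\<lambda>y. Im (g' (sgn y))) (r *\<^sub>R x) =
      c * (s / r)\<^sup>2 * laplace_beltrami (Sph s) (\<lambda>y. Im (g (sgn y))) (s *\<^sub>R x)"
    unfolding rx by (rule laplace_beltrami_Sph_scale[OF r s c sx]) (simp only: sgn_eq, simp)
  ultimately show ?thesis
    by (simp add: Delta_Gamma_def laplace_beltrami_complex_def complex_eq_iff)
qed

text \<open>The law makes \<open>f\<close> an explicit power on a neighbourhood of \<open>r\<close>,
  so the derivative exists and is not a default value.\<close>

lemma vector_derivative_inverse_power_law:
  fixes f :: "real \<Rightarrow> complex"
  assumes "r > 0" and f: "\<And>t. t > 0 \<Longrightarrow> f t = of_real (c * (s / t) ^ M) * A"
  shows "vector_derivative f (at r) = of_real (- (c * real M * (s / r) ^ M / r)) * A"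
proof (rule vector_derivative_at)
  have "((\<lambda>t. c * (s / t) ^ M) has_real_derivative - (c * real M * (s / r) ^ M / r)) (at r)"
  proof (cases M)
    case (Suc m)
    have "((\<lambda>t. s / t) has_real_derivative - (s / r / r)) (at r)"
      using \<open>r > 0\<close> by (auto intro!: derivative_eq_intros)
    from DERIV_cmult[OF DERIV_power[OF this, of M], of c]
    show ?thesis by (simp add: Suc mult_ac)
  qed simp
  hence "((\<lambda>t. of_real (c * (s / t) ^ M) :: complex) has_vector_derivative
      of_real (- (c * real M * (s / r) ^ M / r))) (at r)"
    by (intro has_vector_derivative_of_real)
      (simp add: has_real_derivative_iff_has_vector_derivative)
  hence "((\<lambda>t. of_real (c * (s / t) ^ M) * A) has_vector_derivative
      of_real (- (c * real M * (s / r) ^ M / r)) * A) (at r)"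
    by (rule has_vector_derivative_mult_left)
  thus "(f has_vector_derivative of_real (- (c * real M * (s / r) ^ M / r)) * A) (at r)"
    by (rule has_vector_derivative_transform_within_open[of _ _ _ "{0<..}"])
      (use \<open>r > 0\<close> f in auto)
qed

text \<open>The relation between \<open>g'\<close> and \<open>g\<close> packs three facts into one
  induction: \<open>c = 1\<close> gives the scaling and the dependence on sphere values only,
  \<open>r = s\<close> gives homogeneity.\<close>

lemma dtn_symbol_scale:
  assumes "r > 0" "s > 0" "c \<noteq> 0" "x \<in> Sph 1" "\<And>y. y \<in> Sph 1 \<Longrightarrow> g' y = of_real c * g y"
  shows "dtn_symbol k (1 - int N) r g' x =
    of_real (c * (s / r) ^ N) * dtn_symbol k (1 - int N) s g x"
  using assms
proof (induction N arbitrary: r s c g g' x rule: less_induct)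
  case (less N)
  note r = less.prems(1) and s = less.prems(2) and c = less.prems(3) and x = less.prems(4)
    and eq = less.prems(5)
  consider "N = 0" | "N = 1" | "N = 2" | M where "N = Suc M" "M \<ge> 2"
    by (metis One_nat_def Suc_1 not_less_eq_eq not0_implies_Suc le_zero_eq le_Suc_eq)
  thus ?case
  proof cases
    case 1
    thus ?thesis using eq[OF x] by (simp add: dtn_symbol_1)
  next
    case 2
    thus ?thesis using eq[OF x] r s x by (simp add: dtn_symbol_0 curvature_Gamma)
  next
    case 3
    thus ?thesis
      using Delta_Gamma_scale[OF r s c x eq] r s x
      by (simp add: dtn_symbol_minus_1 curvature_Gamma power_one_over)
  next
    case (4 M)
    define n where "n = int M - 1"
    have n: "n \<ge> 1" "1 - int N = - n - 1" "- n = 1 - int M"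
      using 4 by (auto simp: n_def)
    let ?A = "dtn_symbol k (- n) s g x"
    let ?C = "complex_of_real (c * (s / r) ^ N)"
    have "vector_derivative (\<lambda>t. dtn_symbol k (- n) t g' x) (at r) =
        of_real (- (c * real M * (s / r) ^ M / r)) * ?A"
      unfolding n(3) by (rule vector_derivative_inverse_power_law[OF r], rule less.IH)
        (use 4 s c x eq in auto)
    \<comment> \<open>The same law with \<open>c = 1\<close> and evaluation at \<open>s\<close>.
      Both derivatives are multiples of \<open>?A\<close>; comparing \<open>(s / r) ^ M / r\<close>
      with \<open>1 / s\<close> supplies the extra factor \<open>s / r\<close>.\<close>
    moreover have "vector_derivative (\<lambda>t. dtn_symbol k (- n) t g x) (at s) =
        of_real (- (1 * real M * (s / s) ^ M / s)) * ?A"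
      unfolding n(3) by (rule vector_derivative_inverse_power_law[OF s], rule less.IH)
        (use 4 s x in auto)
    ultimately have deriv: "vector_derivative (\<lambda>t. dtn_symbol k (- n) t g' x) (at r) =
        ?C * vector_derivative (\<lambda>t. dtn_symbol k (- n) t g x) (at s)"
      using r s by (simp add: 4)
    have comp: "dtn_symbol k (- j) r (dtn_symbol k (j - n) r g') x =
        ?C * dtn_symbol k (- j) s (dtn_symbol k (j - n) s g) x" if j: "j \<in> {1..n - 1}" for j
    proof -
      \<comment> \<open>Exponents of the inner and outer symbol. They sum to
        \<open>n + 2 = N\<close>, and each is at least 2, hence below \<open>N\<close>.\<close>
      define a b where "a = nat (n - j + 1)" and "b = nat (j + 1)"
      have ab: "j - n = 1 - int a" "- j = 1 - int b" "a < N" "b < N" "N = a + b"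
        using j 4 by (auto simp: a_def b_def n_def)
      \<comment> \<open>Holding on the whole unit sphere, this is the hypothesis for the outer
        symbol, with the new constant \<open>c * (s / r) ^ a\<close>.\<close>
      have inner: "dtn_symbol k (1 - int a) r g' y =
          of_real (c * (s / r) ^ a) * dtn_symbol k (1 - int a) s g y" if "y \<in> Sph 1" for y
        by (rule less.IH) (use ab r s c that eq in auto)
      have "c * (s / r) ^ a \<noteq> 0" using r s c by simp
      from less.IH[OF ab(4) r s this x inner]
      show ?thesis
        unfolding ab(1,2) by (simp add: ab(5) power_add)
    qed
    have sum: "(\<Sum>j = 1..n - 1. dtn_symbol k (- j) r (dtn_symbol k (j - n) r g') x) =
        ?C * (\<Sum>j = 1..n - 1. dtn_symbol k (- j) s (dtn_symbol k (j - n) s g) x)"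
      unfolding sum_distrib_left by (rule sum.cong[OF refl comp])
    show ?thesis
      unfolding n(2) dtn_symbol_rec[OF n(1)] deriv sum by (simp only: ring_distribs mult_ac)
  qed
qed

theorem lemma1:
  fixes k r_o r :: real and n :: int and g :: "real^3 \<Rightarrow> complex" and x :: "real^3"
  assumes "k > 0" and "r_o > 0" and "n \<ge> -1" and "r > 0"
    and "g \<in> smooth_sphere" and "x \<in> Sph 1"
  shows "dtn_symbol k (- n) r g x =
    of_real ((r_o / r) powi (n + 1)) * dtn_symbol k (- n) r_o g x"
proof -
  \<comment> \<open>As \<open>n \<ge> -1\<close>, the integer exponent is a natural number, the
    \<open>N\<close> of the induction.\<close>
  have "- n = 1 - int (nat (n + 1))" "(r_o / r) powi (n + 1) = (r_o / r) ^ nat (n + 1)"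
    using assms(3) by (auto simp: power_int_def)
  thus ?thesis
    using dtn_symbol_scale[OF assms(4,2) _ assms(6), of 1 g g k "nat (n + 1)"] by simp
qed

end
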